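(* Let $n,r,k \in \mathbb{N}$ with $r \geqslant 3$, $r+1$ a power of $2$, and $n \geqslant 16kr^2 + 4kr$. Then $$\frac{4n}{r+1} - 5kr(r+2k+1) \;\leqslant\; m(n,r,2,k) \;\leqslant\; \frac{4n}{r+1} + 4.$$ In particular, if $k$ and $r$ are fixed, then $m(n,r,2,k) = \frac{4n}{r+1} + o(n)$ as $n \to \infty$.
   Context: An $r$-colouring of the complete graph $K_n$ ($n \geqslant 2$) is any function $f: E(K_n) \to [r] = \{1,\dots,r\}$. For a subgraph $H \subseteq K_n$, $c_f(H) = |f(E(H))|$ is the number of distinct colours on edges of $H$. A graph on at least $k+1$ vertices is $k$-connected if deleting any at most $k-1$ vertices leaves a connected graph. $M(f,n,r,s,k)$ is the maximum number of vertices of a $k$-connected subgraph $H \subseteq K_n$ with $c_f(H) \leqslant s$ (taken to be $0$ if no such subgraph exists), and $m(n,r,s,k) = \min_f M(f,n,r,s,k)$, the minimum over all $r$-colourings $f$ of $E(K_n)$. *)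

theory Defs
  imports Complex_Main "HOL-Library.FuncSet" "HOL-Library.Landau_Symbols"
begin

text \<open>
  A graph is given by a vertex set \<open>V\<close> and an edge set \<open>E \<subseteq> complete_edges V\<close>; the complete graph
  \<open>K\<^sub>n\<close> has vertex set \<open>{1..n}\<close> and edge set \<open>complete_edges {1..n}\<close>.
\<close>

definition complete_edges :: "'a set \<Rightarrow> 'a set set" where
  "complete_edges V = {e. e \<subseteq> V \<and> card e = 2}"

definition graph_connected :: "'a set \<Rightarrow> 'a set set \<Rightarrow> bool" where
  "graph_connected V E \<longleftrightarrow> V \<noteq> {} \<and> (\<forall>u\<in>V. \<forall>v\<in>V. (u, v) \<in> {(x, y). {x, y} \<in> E}\<^sup>*)"

text \<open>
  At most \<open>k - 1\<close> deleted vertices is written \<open>card S < k\<close>, avoiding truncated subtraction.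
  The size condition forces \<open>V\<close> to be finite, as infinite sets have cardinality \<open>0\<close>.
\<close>

definition k_connected :: "nat \<Rightarrow> 'a set \<Rightarrow> 'a set set \<Rightarrow> bool" where
  "k_connected k V E \<longleftrightarrow>
     card V \<ge> k + 1 \<and>
     (\<forall>S. S \<subseteq> V \<and> card S < k \<longrightarrow> graph_connected (V - S) {e \<in> E. e \<inter> S = {}})"

definition colourings :: "nat \<Rightarrow> nat \<Rightarrow> (nat set \<Rightarrow> nat) set" where
  "colourings n r = complete_edges {1..n} \<rightarrow>\<^sub>E {1..r}"

definition num_colours :: "('a set \<Rightarrow> nat) \<Rightarrow> 'a set set \<Rightarrow> nat" where
  "num_colours f E = card (f ` E)"

text \<open>
  The number \<open>r\<close> of available colours enters \<open>M(f,n,r,s,k)\<close> only through the choice of \<open>f\<close>, so it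
  is not an argument here. Inserting \<open>0\<close> gives the value \<open>0\<close> when there is no such subgraph.
\<close>

definition max_kconn :: "(nat set \<Rightarrow> nat) \<Rightarrow> nat \<Rightarrow> nat \<Rightarrow> nat \<Rightarrow> nat" where
  "max_kconn f n s k =
     Max (insert 0 {card V | V E. V \<subseteq> {1..n} \<and> E \<subseteq> complete_edges V \<and>
                                  k_connected k V E \<and> num_colours f E \<le> s})"

definition min_max_kconn :: "nat \<Rightarrow> nat \<Rightarrow> nat \<Rightarrow> nat \<Rightarrow> nat" where
  "min_max_kconn n r s k = Min {max_kconn f n s k | f. f \<in> colourings n r}"

end

theory Submission
  imports Defs
begin

text \<open>
  Upper bound: identify the residues modulo \<open>r + 1 = 2 ^ j\<close> with the group \<open>(Z/2)\<^sup>j\<close> and colour an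
  edge by the difference of the classes of its endpoints. A connected subgraph in two colours stays
  in a coset of a subgroup of order at most \<open>4\<close>.

  Lower bound: let \<open>C\<close> be a largest monochromatic \<open>k\<close>-connected piece, with \<open>c\<close> vertices and in
  colour \<open>i0\<close>, and let \<open>X i\<close> be the set of vertices outside \<open>C\<close> with at least \<open>k\<close> edges of colour \<open>i\<close>
  to \<open>C\<close>. Then \<open>C \<union> X i\<close> is \<open>k\<close>-connected in the colours \<open>i0\<close> and \<open>i\<close>. Suppose that
  \<open>c + \<bar>X i\<bar> \<le> M\<close> for all \<open>i\<close>. Ignoring error terms, a bipartite graph all of whose \<open>k\<close>-connected
  pieces have at most \<open>c\<close> vertices has average degree at most \<open>c/2\<close>; summing over the \<open>r - 1\<close> graphs
  between \<open>C\<close> and \<open>X i\<close> gives \<open>c (n - c) \<le> (r - 1) c M / 4\<close>, so \<open>M < 4n/(r+1)\<close> forces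
  \<open>c \<ge> 2n/(r+1)\<close>. On the other hand almost every vertex outside \<open>C\<close> lies in two of the sets \<open>X i\<close>, as
  otherwise a bipartite graph in one colour beats \<open>C\<close>; hence some \<open>X i\<close> has at least
  \<open>2(n - c)/(r - 1)\<close> vertices, and \<open>c + 2(n - c)/(r - 1) \<ge> 4n/(r+1)\<close> when \<open>c \<ge> 2n/(r+1)\<close>.
\<close>

section \<open>Highly connected graphs\<close>

text \<open>Any vertex reaches \<open>H\<close> in at most one step, and reachability is symmetric
  because edges are unordered. Below, \<open>H\<close> is what a deletion leaves of a well-connected
  core.\<close>

lemma graph_connected_hub:
  assumes H: "H \<subseteq> V" "H \<noteq> {}"
    and conn: "\<And>u v. u \<in> H \<Longrightarrow> v \<in> H \<Longrightarrow> (u, v) \<in> {(x, y). {x, y} \<in> E}\<^sup>*"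
    and reach: "\<And>x. x \<in> V - H \<Longrightarrow> \<exists>u\<in>H. {x, u} \<in> E"
  shows "graph_connected V E"
proof -
  let ?R = "{(x, y). {x, y} \<in> E}"
  have sym: "sym (?R\<^sup>*)"
    by (intro sym_rtrancl) (auto simp: sym_def insert_commute)
  have hub: "\<exists>u\<in>H. (x, u) \<in> ?R\<^sup>*" if x: "x \<in> V" for x
  proof (cases "x \<in> H")
    case False
    then obtain u where "u \<in> H" "{x, u} \<in> E" using reach x by blast
    then show ?thesis by auto
  qed auto
  have "(x, y) \<in> ?R\<^sup>*" if xy: "x \<in> V" "y \<in> V" for x y
  proof -
    obtain u where u: "u \<in> H" "(x, u) \<in> ?R\<^sup>*" using hub xy by blast
    obtain v where v: "v \<in> H" "(y, v) \<in> ?R\<^sup>*" using hub xy by blast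
    have "(v, y) \<in> ?R\<^sup>*" using sym v(2) by (rule symD)
    then show ?thesis by (rule rtrancl_trans[OF u(2) rtrancl_trans[OF conn[OF u(1) v(1)]]])
  qed
  then show ?thesis using H unfolding graph_connected_def by auto
qed

text \<open>\<open>A\<close> is the set of vertices reachable from some \<open>u\<close> that fails
  to reach some \<open>v\<close>. The empty graph counts as disconnected without having such a
  split, hence \<open>V \<noteq> {}\<close>.\<close>

lemma not_graph_connected_split:
  assumes "\<not> graph_connected V E" "V \<noteq> {}"
  obtains A B where "V = A \<union> B" "A \<inter> B = {}" "A \<noteq> {}" "B \<noteq> {}"
    "\<And>x y. x \<in> A \<Longrightarrow> y \<in> B \<Longrightarrow> {x, y} \<notin> E"
proof -
  let ?R = "{(x, y). {x, y} \<in> E}"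
  obtain u v where uv: "u \<in> V" "v \<in> V" "(u, v) \<notin> ?R\<^sup>*"
    using assms unfolding graph_connected_def by auto
  let ?A = "{x \<in> V. (u, x) \<in> ?R\<^sup>*}"
  show thesis
  proof
    show "V = ?A \<union> (V - ?A)" "?A \<inter> (V - ?A) = {}" "?A \<noteq> {}" "V - ?A \<noteq> {}"
      using uv by auto
    show "{x, y} \<notin> E" if "x \<in> ?A" "y \<in> V - ?A" for x y
    proof
      assume "{x, y} \<in> E"
      then have "(x, y) \<in> ?R" by simp
      moreover have "(u, x) \<in> ?R\<^sup>*" using that(1) by simp
      ultimately have "(u, y) \<in> ?R\<^sup>*" by (rule rtrancl_into_rtrancl[rotated])
      then show False using that(2) by blast
    qed
  qed
qed

lemma exists_not_in_small:
  assumes "finite S" "card S < k" "k \<le> card N"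
  obtains x where "x \<in> N" "x \<notin> S"
proof -
  have "\<not> N \<subseteq> S"
    using assms card_mono by (metis leD le_trans)
  then show thesis using that by blast
qed

lemma k_connected_finite: "k_connected k V E \<Longrightarrow> finite V"
  unfolding k_connected_def by (metis add_is_0 card.infinite le_zero_eq one_neq_zero)

lemma k_connected_mono:
  assumes "k_connected k V E" "E \<subseteq> F"
  shows "k_connected k V F"
proof -
  have "graph_connected W F'" if "graph_connected W E'" "E' \<subseteq> F'" for W and E' F' :: "'a set set"
  proof -
    have "{(x, y). {x, y} \<in> E'}\<^sup>* \<subseteq> {(x, y). {x, y} \<in> F'}\<^sup>*"
      using that(2) by (intro rtrancl_mono) auto
    then show ?thesis using that(1) unfolding graph_connected_def by blast
  qed
  moreover have "{e \<in> E. e \<inter> S = {}} \<subseteq> {e \<in> F. e \<inter> S = {}}" for S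
    using assms(2) by auto
  ultimately have "graph_connected (V - S) {e \<in> F. e \<inter> S = {}}"
    if "graph_connected (V - S) {e \<in> E. e \<inter> S = {}}" for S
    using that by blast
  then show ?thesis using assms(1) unfolding k_connected_def by simp
qed

text \<open>Deleting fewer than \<open>k\<close> vertices leaves \<open>C\<close> connected, and
  every surviving vertex of \<open>X\<close> keeps a neighbour in \<open>C\<close>, so
  \<open>C - S\<close> is a hub.\<close>

lemma k_connected_Un:
  assumes C: "k_connected k C E" and E: "E \<subseteq> complete_edges C" "E \<subseteq> F" and X: "finite X"
    and deg: "\<And>x. x \<in> X \<Longrightarrow> k \<le> card {u \<in> C. {x, u} \<in> F}"
  shows "k_connected k (C \<union> X) F"
  unfolding k_connected_def
proof (intro conjI allI impI)
  have fC: "finite C" using C by (rule k_connected_finite)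
  have "k + 1 \<le> card C" using C unfolding k_connected_def by simp
  then show "k + 1 \<le> card (C \<union> X)" using fC X by (meson Un_upper1 card_mono finite_UnI le_trans)
  fix S assume S: "S \<subseteq> C \<union> X \<and> card S < k"
  then have fS: "finite S" using fC X finite_subset by blast
  have "card (S \<inter> C) < k" using S fS by (meson Int_lower1 card_mono le_less_trans)
  then have con: "graph_connected (C - S \<inter> C) {e \<in> E. e \<inter> (S \<inter> C) = {}}"
    using C unfolding k_connected_def by auto
  let ?F = "{e \<in> F. e \<inter> S = {}}"
  \<comment> \<open>Edges of \<open>E\<close> lie inside \<open>C\<close>, so those avoiding
    \<open>S \<inter> C\<close> avoid all of \<open>S\<close>.\<close>
  have sub: "{(x, y). {x, y} \<in> {e \<in> E. e \<inter> (S \<inter> C) = {}}}\<^sup>* \<subseteq> {(x, y). {x, y} \<in> ?F}\<^sup>*"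
    using E by (intro rtrancl_mono) (auto simp: complete_edges_def)
  have eq: "C - S \<inter> C = C - S" by auto
  show "graph_connected (C \<union> X - S) ?F"
  proof (rule graph_connected_hub)
    show "C - S \<subseteq> C \<union> X - S" by auto
    show "C - S \<noteq> {}" using con unfolding graph_connected_def eq by simp
    show "(u, v) \<in> {(x, y). {x, y} \<in> ?F}\<^sup>*" if "u \<in> C - S" "v \<in> C - S" for u v
      using con sub that unfolding graph_connected_def eq by blast
    fix x assume x: "x \<in> C \<union> X - S - (C - S)"
    then have "k \<le> card {u \<in> C. {x, u} \<in> F}" using deg by auto
    then obtain u where "u \<in> {u \<in> C. {x, u} \<in> F}" "u \<notin> S"
      using exists_not_in_small[OF fS] S by blast
    then show "\<exists>u\<in>C - S. {x, u} \<in> ?F" using x by auto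
  qed
qed

text \<open>The hub is \<open>T - S\<close>: of the \<open>k\<close> common neighbours of two
  vertices of \<open>T\<close> one survives the deletion, and every vertex of \<open>W\<close> keeps
  a neighbour in \<open>T\<close>.\<close>

lemma k_connected_bipartite:
  assumes k: "0 < k" and fin: "finite T" "finite W" "T \<inter> W = {}" and T: "k \<le> card T"
    and degW: "\<And>u. u \<in> W \<Longrightarrow> k \<le> card {v \<in> T. {u, v} \<in> E}"
    and codeg: "\<And>v v'. v \<in> T \<Longrightarrow> v' \<in> T \<Longrightarrow> k \<le> card {u \<in> W. {u, v} \<in> E \<and> {u, v'} \<in> E}"
  shows "k_connected k (T \<union> W) E"
  unfolding k_connected_def
proof (intro conjI allI impI)
  obtain v where "v \<in> T" using k T by fastforce
  then have "W \<noteq> {}" using codeg[of v v] k by auto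
  then have "card W > 0" using fin by auto
  then show "k + 1 \<le> card (T \<union> W)" using T fin by (simp add: card_Un_disjoint)
  fix S assume S: "S \<subseteq> T \<union> W \<and> card S < k"
  then have fS: "finite S" using fin finite_subset by blast
  let ?F = "{e \<in> E. e \<inter> S = {}}"
  show "graph_connected (T \<union> W - S) ?F"
  proof (rule graph_connected_hub)
    show "T - S \<subseteq> T \<union> W - S" by auto
    show "T - S \<noteq> {}" using exists_not_in_small[OF fS _ T] S by blast
    show "(v, v') \<in> {(x, y). {x, y} \<in> ?F}\<^sup>*" if v: "v \<in> T - S" "v' \<in> T - S" for v v'
    proof -
      have "k \<le> card {u \<in> W. {u, v} \<in> E \<and> {u, v'} \<in> E}" using codeg v by auto
      then obtain u where "u \<in> {u \<in> W. {u, v} \<in> E \<and> {u, v'} \<in> E}" "u \<notin> S"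
        using exists_not_in_small[OF fS] S by blast
      then have "(v, u) \<in> {(x, y). {x, y} \<in> ?F}" "(u, v') \<in> {(x, y). {x, y} \<in> ?F}"
        using v by (auto simp: insert_commute)
      then show ?thesis by (meson r_into_rtrancl rtrancl.rtrancl_into_rtrancl)
    qed
    fix u assume u: "u \<in> T \<union> W - S - (T - S)"
    then have "k \<le> card {v \<in> T. {u, v} \<in> E}" using degW by auto
    then obtain v where "v \<in> {v \<in> T. {u, v} \<in> E}" "v \<notin> S"
      using exists_not_in_small[OF fS] S by blast
    then show "\<exists>v\<in>T - S. {u, v} \<in> ?F" using u by auto
  qed
qed

lemma sum_card_swap:
  assumes "finite A" "finite B"
  shows "(\<Sum>a\<in>A. card {b \<in> B. P a b}) = (\<Sum>b\<in>B. card {a \<in> A. P a b})"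
  using sum_multicount_gen[OF assms, of P "\<lambda>b. card {a \<in> A. P a b}"] by simp

text \<open>\<open>W\<close> discards the vertices of \<open>C\<close> with fewer than
  \<open>k\<close> neighbours in \<open>T\<close>. Each of them misses at least half of
  \<open>T\<close>, while at most \<open>card T * s\<close> pairs are missing, so at most
  \<open>2 * s\<close> vertices are discarded.\<close>

lemma k_connected_almost_complete_bipartite:
  assumes k: "0 < k" and fin: "finite T" "finite C" "T \<inter> C = {}" and T: "2 * k \<le> card T"
    and miss: "\<And>v. v \<in> T \<Longrightarrow> card {u \<in> C. {u, v} \<notin> E} \<le> s"
    and C: "4 * s + k \<le> card C"
  obtains W where "W \<subseteq> C" "card C \<le> card W + 2 * s" "k_connected k (T \<union> W) {e \<in> E. e \<subseteq> T \<union> W}"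
proof -
  define W where "W = {u \<in> C. k \<le> card {v \<in> T. {u, v} \<in> E}}"
  have WC: "W \<subseteq> C" "finite W" using fin by (auto simp: W_def)
  have "card T \<le> 2 * card {v \<in> T. {u, v} \<notin> E}" if "u \<in> C - W" for u
  proof -
    have "card {v \<in> T. {u, v} \<in> E} < k" using that by (auto simp: W_def)
    moreover have "card T = card {v \<in> T. {u, v} \<in> E} + card {v \<in> T. {u, v} \<notin> E}"
      using fin by (subst card_Un_disjoint[symmetric]) (auto intro: arg_cong[where f=card])
    ultimately show ?thesis using T by linarith
  qed
  then have "card (C - W) * card T \<le> (\<Sum>u\<in>C - W. 2 * card {v \<in> T. {u, v} \<notin> E})"
    using sum_mono[of "C - W" "\<lambda>u. card T"] by simp
  also have "\<dots> \<le> (\<Sum>u\<in>C. 2 * card {v \<in> T. {u, v} \<notin> E})"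
    using fin by (intro sum_mono2) auto
  also have "\<dots> = 2 * (\<Sum>v\<in>T. card {u \<in> C. {u, v} \<notin> E})"
    using sum_card_swap[OF fin(2,1), of "\<lambda>u v. {u, v} \<notin> E"] by (simp add: sum_distrib_left[symmetric])
  also have "\<dots> \<le> 2 * (card T * s)"
    using sum_mono[of T _ "\<lambda>v. s"] miss by simp
  finally have "card T * card (C - W) \<le> card T * (2 * s)" by (simp add: ac_simps)
  then have "card (C - W) \<le> 2 * s" using T k by simp
  moreover have "card C = card W + card (C - W)"
    using card_Diff_subset[OF WC(2,1)] card_mono[OF fin(2) WC(1)] by linarith
  ultimately have W: "card C \<le> card W + 2 * s" by linarith
  have "k_connected k (T \<union> W) {e \<in> E. e \<subseteq> T \<union> W}"
  proof (rule k_connected_bipartite)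
    show "0 < k" "finite T" "finite W" "T \<inter> W = {}" "k \<le> card T"
      using k fin WC T by auto
    show "k \<le> card {v \<in> T. {u, v} \<in> {e \<in> E. e \<subseteq> T \<union> W}}" if "u \<in> W" for u
    proof -
      have "{v \<in> T. {u, v} \<in> {e \<in> E. e \<subseteq> T \<union> W}} = {v \<in> T. {u, v} \<in> E}" using that by auto
      then show ?thesis using that by (simp add: W_def)
    qed
    show "k \<le> card {u \<in> W. {u, v} \<in> {e \<in> E. e \<subseteq> T \<union> W} \<and> {u, v'} \<in> {e \<in> E. e \<subseteq> T \<union> W}}"
      (is "_ \<le> card ?N") if v: "v \<in> T" "v' \<in> T" for v v'
    proof -
      \<comment> \<open>\<open>W\<close> keeps at least \<open>2 * s + k\<close> vertices, and
        \<open>v\<close> and \<open>v'\<close> miss at most \<open>s\<close> of them each.\<close>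
      have "W \<subseteq> ?N \<union> ({u \<in> C. {u, v} \<notin> E} \<union> {u \<in> C. {u, v'} \<notin> E})"
        using v WC by auto
      then have "card W \<le> card (?N \<union> ({u \<in> C. {u, v} \<notin> E} \<union> {u \<in> C. {u, v'} \<notin> E}))"
        using fin WC by (intro card_mono) auto
      also have "\<dots> \<le> card ?N + (card {u \<in> C. {u, v} \<notin> E} + card {u \<in> C. {u, v'} \<notin> E})"
        by (meson add_left_mono card_Un_le le_trans)
      finally show ?thesis using miss[OF v(1)] miss[OF v(2)] W C by linarith
    qed
  qed
  then show thesis using that WC W by blast
qed

section \<open>Edge counts in the absence of large \<open>k\<close>-connected subgraphs\<close>

text \<open>As \<open>V\<close> has enough vertices, only a cutset \<open>S\<close> can be to blame.
  The larger side is called \<open>A\<close>, so that \<open>A \<union> S\<close> stays large enough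
  for an induction.\<close>

lemma not_k_connected_split:
  assumes V: "finite V" "k < card V" and "\<not> k_connected k V {e \<in> E. e \<subseteq> V}"
    and E: "\<And>e. e \<in> E \<Longrightarrow> card e = 2"
  obtains A B S where "V = A \<union> B \<union> S" "A \<inter> B = {}" "A \<inter> S = {}" "B \<inter> S = {}"
    "A \<noteq> {}" "B \<noteq> {}" "card S < k" "card B \<le> card A"
    "\<And>e. e \<in> E \<Longrightarrow> e \<subseteq> V \<Longrightarrow> e \<subseteq> A \<union> S \<or> e \<subseteq> B \<union> S"
proof -
  obtain S where S: "S \<subseteq> V" "card S < k"
    and nc: "\<not> graph_connected (V - S) {e \<in> {e \<in> E. e \<subseteq> V}. e \<inter> S = {}}"
    using assms unfolding k_connected_def by auto
  have "finite S" using S V finite_subset by blast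
  then have "V - S \<noteq> {}" using card_mono[of S V] S(2) V(2) by auto
  then obtain A B where AB: "V - S = A \<union> B" "A \<inter> B = {}" "A \<noteq> {}" "B \<noteq> {}"
    and no: "\<And>x y. x \<in> A \<Longrightarrow> y \<in> B \<Longrightarrow> {x, y} \<notin> {e \<in> {e \<in> E. e \<subseteq> V}. e \<inter> S = {}}"
    by (rule not_graph_connected_split[OF nc]) (rule that)
  have edge: "e \<subseteq> A \<union> S \<or> e \<subseteq> B \<union> S" if e: "e \<in> E" "e \<subseteq> V" for e
  proof (rule ccontr)
    assume neg: "\<not> (e \<subseteq> A \<union> S \<or> e \<subseteq> B \<union> S)"
    obtain x y where xy: "e = {x, y}" using E[OF e(1)] by (auto simp: card_2_iff)
    have "e \<inter> S = {}" "(x \<in> A \<and> y \<in> B) \<or> (x \<in> B \<and> y \<in> A)"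
      using neg e AB unfolding xy by auto
    then show False using no[of x y] no[of y x] e xy by (auto simp: insert_commute)
  qed
  show thesis
  proof (cases "card B \<le> card A")
    case True
    show thesis using that[of A B S] AB S edge True by blast
  next
    case False
    then have "card A \<le> card B" by simp
    then show thesis using that[of B A S] AB S edge by blast
  qed
qed

text \<open>An edge is determined by an endpoint in \<open>B\<close> and its other endpoint in
  \<open>P\<close>. This serves to count the edges at the small side of a cut.\<close>

lemma card_edges_meeting:
  assumes "finite P" "B \<subseteq> P" and E: "\<And>e. e \<in> E \<Longrightarrow> card e = 2 \<and> e \<subseteq> P \<and> e \<inter> B \<noteq> {}"
  shows "card E \<le> card B * card P"
proof -
  have "E \<subseteq> (\<lambda>(x, y). {x, y}) ` (B \<times> P)"
  proof
    fix e assume e: "e \<in> E"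
    then obtain b where b: "b \<in> e" "b \<in> B" using E by blast
    obtain x y where xy: "e = {x, y}" using E[OF e] by (auto simp: card_2_iff)
    have "e = {b, if b = x then y else x}" using b xy by auto
    moreover have "(if b = x then y else x) \<in> P" using E[OF e] xy by auto
    ultimately show "e \<in> (\<lambda>(x, y). {x, y}) ` (B \<times> P)" using b by (auto intro!: image_eqI)
  qed
  then have "card E \<le> card (B \<times> P)"
    using assms by (meson finite_SigmaI finite_subset surj_card_le)
  then show ?thesis by (simp add: card_cartesian_product)
qed

text \<open>
  Split along a cutset of fewer than \<open>k\<close> vertices, keeping the cutset in both parts. The term
  \<open>- (k - 1)\<close> occurs once for each part and so pays for the vertices counted twice, which keeps
  the loss independent of the number of splits.
\<close>

lemma edge_bound:
  fixes a L :: real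
  assumes W: "finite W" and E: "\<And>e. e \<in> E \<Longrightarrow> card e = 2"
    and k: "0 < k" and a: "0 < a" "a \<le> 1 / 2" and L: "2 * real k \<le> a * L"
    and dens: "\<And>U. U \<subseteq> W \<Longrightarrow> real (card {e \<in> E. e \<subseteq> U}) \<le> a * (real (card U))\<^sup>2"
    and conn: "\<And>U. U \<subseteq> W \<Longrightarrow> k_connected k U {e \<in> E. e \<subseteq> U} \<Longrightarrow> real (card U) \<le> L"
    and V: "V \<subseteq> W" "2 * k \<le> card V"
  shows "real (card {e \<in> E. e \<subseteq> V}) \<le> a * (L + 2 * real k) * (real (card V) - (real k - 1))"
proof -
  have "a * L \<le> (1 / 2) * L"
  proof (rule mult_right_mono)
    have "0 < a * L" using L k by linarith
    then show "0 \<le> L" using a by (simp add: zero_less_mult_iff)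
  qed (use a in simp)
  then have L4: "4 * real k \<le> L" using L by linarith
  have fV: "finite V" using V W finite_subset by blast
  then show ?thesis using V
  proof (induction V rule: finite_psubset_induct)
    case (psubset V)
    let ?I = "\<lambda>U. {e \<in> E. e \<subseteq> U}"
    have finI: "finite (?I U)" if "U \<subseteq> V" for U
    proof -
      have "?I U \<subseteq> Pow V" using that by auto
      then show ?thesis using psubset.hyps by (meson finite_Pow_iff finite_subset)
    qed
    define c where "c = a * (L + 2 * real k)"
    have c0: "c > 0" using a L4 k by (simp add: c_def)
    show ?case
    proof (cases "real (card V) \<le> L")
      case True
      let ?v = "real (card V)"
      have v: "2 * real k \<le> ?v" using psubset.prems(2) by linarith
      \<comment> \<open>By \<open>dens\<close> it suffices to bound the square of \<open>?v\<close>
        by a linear function on the interval from \<open>2 * k\<close> to \<open>L\<close>; this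
        product expresses convexity.\<close>
      have "0 \<le> (?v - 2 * real k) * (L - ?v)" using v True by simp
      moreover have "(L + 2 * real k) * (real k - 1) \<le> (2 * L) * real k"
        using L4 k by (intro mult_mono) auto
      ultimately have "?v\<^sup>2 \<le> (L + 2 * real k) * (?v - (real k - 1))"
        by (simp add: algebra_simps power2_eq_square)
      then have "a * ?v\<^sup>2 \<le> a * ((L + 2 * real k) * (?v - (real k - 1)))"
        using a by (intro mult_left_mono) auto
      then show ?thesis using dens[OF psubset.prems(1)] by (simp add: mult.assoc)
    next
      case False
      then have nk: "\<not> k_connected k V (?I V)" using conn psubset.prems(1) by auto
      have kV: "k < card V" using psubset.prems(2) k by linarith
      obtain A B S where ABS: "V = A \<union> B \<union> S" "A \<inter> B = {}" "A \<inter> S = {}" "B \<inter> S = {}"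
        "A \<noteq> {}" "B \<noteq> {}" "card S < k" "card B \<le> card A"
        and edge: "\<And>e. e \<in> E \<Longrightarrow> e \<subseteq> V \<Longrightarrow> e \<subseteq> A \<union> S \<or> e \<subseteq> B \<union> S"
        by (rule not_k_connected_split[OF psubset.hyps kV nk E]) (assumption, rule that)
      have fin: "finite A" "finite B" "finite S" using psubset.hyps(1) ABS(1) by auto
      have cV: "card V = card A + card B + card S"
        using ABS fin by (simp add: card_Un_disjoint Int_Un_distrib2)
      have cAS: "card (A \<union> S) = card A + card S" and cBS: "card (B \<union> S) = card B + card S"
        using ABS fin by (simp_all add: card_Un_disjoint)
      have sub: "A \<union> S \<subset> V" "B \<union> S \<subset> V" using ABS by auto
      have kS: "real (card S) \<le> real k - 1" using ABS(7) by linarith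
      \<comment> \<open>\<open>A \<union> S\<close> has at least half of the more than
        \<open>4 * k\<close> vertices.\<close>
      have "2 * k \<le> card (A \<union> S)" using False L4 ABS(8) cV cAS by linarith
      then have IHA: "real (card (?I (A \<union> S))) \<le> c * (real (card (A \<union> S)) - (real k - 1))"
        unfolding c_def using psubset.IH[OF sub(1)] psubset.prems sub by auto
      show ?thesis
      proof (cases "2 * k \<le> card (B \<union> S)")
        case True
        then have IHB: "real (card (?I (B \<union> S))) \<le> c * (real (card (B \<union> S)) - (real k - 1))"
          unfolding c_def using psubset.IH[OF sub(2)] psubset.prems sub by auto
        have "?I V \<subseteq> ?I (A \<union> S) \<union> ?I (B \<union> S)" using edge by auto
        then have "card (?I V) \<le> card (?I (A \<union> S)) + card (?I (B \<union> S))"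
          using finI sub by (meson card_Un_le card_mono finite_UnI le_trans psubset_imp_subset)
        then have "real (card (?I V)) \<le> c * (real (card (A \<union> S)) - (real k - 1))
            + c * (real (card (B \<union> S)) - (real k - 1))" using IHA IHB by linarith
        also have "\<dots> = c * (real (card V) + real (card S) - 2 * (real k - 1))"
          unfolding cV cAS cBS by (simp add: algebra_simps)
        \<comment> \<open>The cutset is counted twice, but one of the two terms
          \<open>real k - 1\<close> absorbs it.\<close>
        also have "\<dots> \<le> c * (real (card V) - (real k - 1))"
          using kS c0 by (intro mult_left_mono) auto
        finally show ?thesis by (simp add: c_def)
      next
        case small: False
        \<comment> \<open>\<open>B \<union> S\<close> is too small for the induction hypothesis.
          Edges meeting \<open>B\<close> are counted directly, at most \<open>2 * k\<close> for each
          vertex of \<open>B\<close>, and \<open>2 * k \<le> a * L \<le> c\<close>.\<close>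
        let ?J = "{e \<in> E. e \<subseteq> B \<union> S \<and> e \<inter> B \<noteq> {}}"
        have "?I V \<subseteq> ?I (A \<union> S) \<union> ?J" using edge by blast
        moreover have "finite ?J" using sub by (intro finite_subset[OF _ finI[of "B \<union> S"]]) auto
        ultimately have "card (?I V) \<le> card (?I (A \<union> S)) + card ?J"
          using finI[of "A \<union> S"] sub by (meson card_Un_le card_mono finite_UnI le_trans psubset_imp_subset)
        moreover have "real (card ?J) \<le> c * real (card B)"
        proof -
          have "card ?J \<le> card B * card (B \<union> S)"
            using fin E by (intro card_edges_meeting) auto
          also have "\<dots> \<le> card B * (2 * k)" using small by (intro mult_left_mono) auto
          finally have "real (card ?J) \<le> real (card B) * (2 * real k)"
            using of_nat_mono[where 'a=real] by fastforce
          also have "\<dots> \<le> real (card B) * c"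
          proof (rule mult_left_mono)
            have "0 \<le> a * (2 * real k)" using a by simp
            then show "2 * real k \<le> c" using L by (simp add: c_def distrib_left)
          qed simp
          finally show ?thesis by (simp add: mult.commute)
        qed
        ultimately have "real (card (?I V)) \<le> c * (real (card (A \<union> S)) - (real k - 1)) + c * real (card B)"
          using IHA by linarith
        also have "\<dots> = c * (real (card V) - (real k - 1))"
          unfolding cV cAS by (simp add: algebra_simps)
        finally show ?thesis by (simp add: c_def)
      qed
    qed
  qed
qed

section \<open>The upper bound\<close>

lemma finite_max_kconn_set:
  fixes n :: nat
  shows "finite {card V | V E. V \<subseteq> {1..n} \<and> E \<subseteq> complete_edges V \<and> k_connected k V E \<and> num_colours f E \<le> s}"
  by (rule finite_subset[of _ "card ` Pow {1..n}"]) auto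

lemma max_kconn_le:
  assumes "\<And>V E. V \<subseteq> {1..n} \<Longrightarrow> E \<subseteq> complete_edges V \<Longrightarrow> k_connected k V E \<Longrightarrow> num_colours f E \<le> s
    \<Longrightarrow> card V \<le> B"
  shows "max_kconn f n s k \<le> B"
  unfolding max_kconn_def using assms finite_max_kconn_set by (subst Max_le_iff) auto

lemma card_le_max_kconn:
  assumes "V \<subseteq> {1..n}" "E \<subseteq> complete_edges V" "k_connected k V E" "num_colours f E \<le> s"
  shows "card V \<le> max_kconn f n s k"
  unfolding max_kconn_def using assms finite_max_kconn_set by (intro Max_ge) auto

lemma finite_complete_edges: "finite V \<Longrightarrow> finite (complete_edges V)"
  unfolding complete_edges_def by (rule finite_subset[of _ "Pow V"]) auto

lemma finite_colourings: "finite (colourings n r)"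
  unfolding colourings_def by (intro finite_PiE finite_complete_edges) auto

lemma min_max_kconn_le:
  assumes "f \<in> colourings n r"
  shows "min_max_kconn n r s k \<le> max_kconn f n s k"
  unfolding min_max_kconn_def using assms finite_colourings
  by (intro Min_le) (auto simp: setcompr_eq_image)

lemma min_max_kconn_attained:
  assumes "1 \<le> r"
  obtains f where "f \<in> colourings n r" "min_max_kconn n r s k = max_kconn f n s k"
proof -
  \<comment> \<open>The constant colouring shows that the minimum is taken over a nonempty
    set.\<close>
  have "(\<lambda>e\<in>complete_edges {1..n}. 1) \<in> colourings n r"
    using assms by (auto simp: colourings_def)
  then have "min_max_kconn n r s k \<in> (\<lambda>f. max_kconn f n s k) ` colourings n r"
    unfolding min_max_kconn_def setcompr_eq_image using finite_colourings
    by (simp only: Collect_mem_eq, intro Min_in) auto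
  then show thesis using that by blast
qed

text \<open>The quotient \<open>v div N\<close> is injective on a residue class and takes at most
  \<open>n div N + 1\<close> values.\<close>

lemma card_residue_class_le:
  fixes N :: nat
  assumes "0 < N"
  shows "card {v \<in> {1..n}. v mod N = c} \<le> n div N + 1"
proof -
  have "inj_on (\<lambda>v. v div N) {v \<in> {1..n}. v mod N = c}"
    by (rule inj_onI) (metis (mono_tags, lifting) div_mult_mod_eq mem_Collect_eq)
  moreover have "(\<lambda>v. v div N) ` {v \<in> {1..n}. v mod N = c} \<subseteq> {0..n div N}"
    by (auto simp: div_le_mono)
  ultimately have "card {v \<in> {1..n}. v mod N = c} \<le> card {0..n div N}"
    by (intro card_inj_on_le) auto
  then show ?thesis by simp
qed

section \<open>The colouring by differences in an elementary abelian 2-group\<close>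

context
  includes bit_operations_syntax
begin

text \<open>\<open>take_bit j\<close> reduces modulo \<open>2 ^ j\<close>, and \<open>XOR\<close> is
  both sum and difference in the group. Zero is no colour, so edges inside a class get colour
  \<open>1\<close>; this is harmless, as they do not change the class.\<close>

definition xor_colouring :: "nat \<Rightarrow> nat \<Rightarrow> nat set \<Rightarrow> nat" where
  "xor_colouring j n = (\<lambda>e\<in>complete_edges {1..n}.
     let d = take_bit j (Min e) XOR take_bit j (Max e) in if d = 0 then 1 else d)"

lemma xor_colouring_edge:
  assumes "{x, y} \<in> complete_edges {1..n}"
  shows "take_bit j y \<in> {take_bit j x, take_bit j x XOR xor_colouring j n {x, y}}"
proof -
  let ?d = "take_bit j x XOR take_bit j y"
  have "take_bit j (Min {x, y}) XOR take_bit j (Max {x, y}) = ?d"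
    by (cases "x \<le> y") (auto simp: min_def max_def xor.commute)
  then have c: "xor_colouring j n {x, y} = (if ?d = 0 then 1 else ?d)"
    using assms by (simp add: xor_colouring_def Let_def)
  have "take_bit j y = take_bit j x XOR ?d"
    by (simp add: xor.assoc[symmetric])
  then show ?thesis using c by (cases "?d = 0") auto
qed

text \<open>\<open>r + 1 = 2 ^ j\<close> makes \<open>r\<close> the largest number of
  \<open>j\<close> bits, so nonzero differences are colours.\<close>

lemma xor_colouring_in_colourings:
  assumes "r + 1 = 2 ^ j" "1 \<le> r"
  shows "xor_colouring j n \<in> colourings n r"
proof -
  have "take_bit j x XOR take_bit j y \<le> r" for x y :: nat
  proof -
    have "take_bit j (x XOR y) < 2 ^ j" by (rule take_bit_nat_less_exp)
    then show ?thesis using assms by (simp add: take_bit_xor)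
  qed
  then show ?thesis using assms
    by (auto simp: colourings_def xor_colouring_def Let_def)
qed

text \<open>
  Walking along edges of colours \<open>a\<close> and \<open>b\<close> never leaves a coset of the subgroup generated by
  \<open>a\<close> and \<open>b\<close> in the elementary abelian group of residues.
\<close>

lemma max_kconn_xor_colouring:
  assumes "1 \<le> k"
  shows "max_kconn (xor_colouring j n) n 2 k \<le> 4 * (n div 2 ^ j + 1)"
proof (rule max_kconn_le)
  fix V E
  assume V: "V \<subseteq> {1..n}" and E: "E \<subseteq> complete_edges V" and conn: "k_connected k V E"
    and col: "num_colours (xor_colouring j n) E \<le> 2"
  let ?f = "xor_colouring j n"
  have "finite V" using V finite_subset by blast
  then have "finite E" using E finite_complete_edges finite_subset by blast
  then have "finite (?f ` E)" by simp
  then obtain a b where ab: "?f ` E \<subseteq> {a, b}"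
  proof -
    consider "card (?f ` E) = 0" | "card (?f ` E) = 1" | "card (?f ` E) = 2"
      using col unfolding num_colours_def by linarith
    then show thesis
      using that \<open>finite (?f ` E)\<close> by cases (auto simp: card_1_singleton_iff card_2_iff, blast+)
  qed
  have "graph_connected (V - {}) {e \<in> E. e \<inter> {} = {}}"
    using conn assms unfolding k_connected_def by (elim conjE allE[of _ "{}"]) auto
  then have gc: "graph_connected V E" by simp
  then obtain u where u: "u \<in> V" unfolding graph_connected_def by blast
  let ?p = "\<lambda>v. take_bit j v"
  let ?Q = "{?p u, ?p u XOR a, ?p u XOR b, ?p u XOR a XOR b}"
  have step: "?p y \<in> ?Q" if "?p x \<in> ?Q" "{x, y} \<in> E" for x y
  proof -
    have "{x, y} \<in> complete_edges V" using that(2) E by blast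
    then have "{x, y} \<in> complete_edges {1..n}" using V unfolding complete_edges_def by blast
    then have "?p y \<in> {?p x, ?p x XOR ?f {x, y}}" by (rule xor_colouring_edge)
    moreover have "?f {x, y} \<in> {a, b}" using ab that(2) by blast
    ultimately have "?p y \<in> {?p x, ?p x XOR a, ?p x XOR b}" by auto
    \<comment> \<open>Adding a colour twice cancels, so \<open>?Q\<close> is closed under adding
      \<open>a\<close> or \<open>b\<close>.\<close>
    moreover have "c XOR (c XOR z) = z" for c z :: nat by (simp add: xor.assoc[symmetric])
    ultimately show ?thesis using that(1) by (auto simp: ac_simps)
  qed
  have coset: "?p v \<in> ?Q" if "v \<in> V" for v
  proof -
    have "(u, v) \<in> {(x, y). {x, y} \<in> E}\<^sup>*" using gc u that unfolding graph_connected_def by blast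
    then show ?thesis by (induction rule: rtrancl_induct) (use step in auto)
  qed
  have "V \<subseteq> (\<Union>c\<in>?Q. {v \<in> {1..n}. v mod 2 ^ j = c})"
    using coset V by (auto simp: take_bit_eq_mod)
  then have "card V \<le> card (\<Union>c\<in>?Q. {v \<in> {1..n}. v mod 2 ^ j = c})"
    by (intro card_mono) auto
  also have "\<dots> \<le> (\<Sum>c\<in>?Q. card {v \<in> {1..n}. v mod 2 ^ j = c})"
    by (rule card_UN_le) simp
  also have "\<dots> \<le> (\<Sum>c\<in>?Q. n div 2 ^ j + 1)"
    by (intro sum_mono card_residue_class_le) simp
  also have "\<dots> = card ?Q * (n div 2 ^ j + 1)" by simp
  also have "\<dots> \<le> 4 * (n div 2 ^ j + 1)"
  proof (rule mult_right_mono)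
    show "card ?Q \<le> 4" using card_length[of "[?p u, ?p u XOR a, ?p u XOR b, ?p u XOR a XOR b]"] by simp
  qed simp
  finally show "card V \<le> 4 * (n div 2 ^ j + 1)" .
qed

end

lemma min_max_kconn_upper:
  assumes "1 \<le> k" "1 \<le> r" "r + 1 = 2 ^ j"
  shows "real (min_max_kconn n r 2 k) \<le> 4 * real n / (real r + 1) + 4"
proof -
  have "min_max_kconn n r 2 k \<le> 4 * (n div (r + 1) + 1)"
    using min_max_kconn_le[OF xor_colouring_in_colourings[OF assms(3,2)]]
      max_kconn_xor_colouring[OF assms(1)] assms(3) by (metis le_trans)
  then have "real (min_max_kconn n r 2 k) \<le> real (4 * (n div (r + 1) + 1))"
    by (rule of_nat_mono)
  also have "\<dots> = 4 * real (n div (r + 1)) + 4" by simp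
  also have "\<dots> \<le> 4 * (real n / (real r + 1)) + 4"
    using of_nat_div_le_of_nat[of n "r + 1", where 'a=real] by (simp add: add.commute)
  finally show ?thesis by simp
qed

section \<open>Largest monochromatic pieces\<close>

text \<open>With a set \<open>J\<close> of colours, one notion serves for pieces in one colour and
  in two.\<close>

definition col_edges :: "('a set \<Rightarrow> nat) \<Rightarrow> nat set \<Rightarrow> 'a set \<Rightarrow> 'a set set" where
  "col_edges f J U = {e \<in> complete_edges U. f e \<in> J}"

lemma col_edges_restrict: "U \<subseteq> V \<Longrightarrow> {e \<in> col_edges f J V. e \<subseteq> U} = col_edges f J U"
  by (auto simp: col_edges_def complete_edges_def)

lemma card_complete_edges: "finite V \<Longrightarrow> real (card (complete_edges V)) = real (card V) * (real (card V) - 1) / 2"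
proof -
  assume "finite V"
  then have "card (complete_edges V) = card V * (card V - 1) div 2"
    unfolding complete_edges_def by (simp add: n_subsets choose_two)
  moreover have "even (card V * (card V - 1))" by (cases "card V") auto
  ultimately have "2 * card (complete_edges V) = card V * (card V - 1)" by simp
  then have "2 * real (card (complete_edges V)) = real (card V) * real (card V - 1)"
    by (metis of_nat_mult of_nat_numeral)
  then show ?thesis by (cases "card V") auto
qed

lemma complete_edges_doubleton: "x \<in> V \<Longrightarrow> y \<in> V \<Longrightarrow> x \<noteq> y \<Longrightarrow> {x, y} \<in> complete_edges V"
  by (simp add: complete_edges_def)

text \<open>If all monochromatic \<open>k\<close>-connected pieces were small,
  \<open>edge_bound\<close> would cap every colour class, and the \<open>r\<close> caps together
  would fall short of the number of edges.\<close>

lemma large_mono_k_connected: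
  assumes V: "finite V" and f: "\<And>e. e \<in> complete_edges V \<Longrightarrow> f e \<in> {1..r}"
    and k: "0 < k" and r: "0 < r" and n: "6 * real k + 1 \<le> (real (card V) - 1) / real r"
  obtains i U where "i \<in> {1..r}" "U \<subseteq> V" "k_connected k U (col_edges f {i} U)"
    "(real (card V) - 1) / real r - 2 * real k - 1 \<le> real (card U)"
proof (rule ccontr)
  assume "\<not> thesis"
  note neg = this and found = that
  define n where "n = real (card V)"
  \<comment> \<open>This makes \<open>L + 2 * real k\<close> equal to
    \<open>(n - 1) / real r - 1\<close>; the last \<open>- 1\<close> keeps the sum of the caps
    strictly too small.\<close>
  define L where "L = (n - 1) / real r - 2 * real k - 1"
  have small: "real (card U) \<le> L"
    if "i \<in> {1..r}" "U \<subseteq> V" "k_connected k U (col_edges f {i} U)" for i U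
    using neg found[OF that] unfolding L_def n_def by linarith
  have "(n - 1) / real r * 1 \<le> (n - 1) / real r * real r"
    using n r k unfolding n_def by (intro mult_left_mono) linarith+
  then have "(n - 1) / real r \<le> n - 1" using r by simp
  then have n2: "6 * real k + 1 \<le> n - 1" using n unfolding n_def by simp
  have bound: "real (card (col_edges f {i} V)) \<le> 1 / 2 * ((n - 1) / real r - 1) * n"
    if i: "i \<in> {1..r}" for i
  proof -
    let ?E = "col_edges f {i} V"
    have "real (card {e \<in> ?E. e \<subseteq> V}) \<le> 1 / 2 * (L + 2 * real k) * (real (card V) - (real k - 1))"
    proof (rule edge_bound[OF V])
      show "card e = 2" if "e \<in> ?E" for e using that by (simp add: col_edges_def complete_edges_def)
      \<comment> \<open>This amounts to the lower bound \<open>6 * real k + 1\<close> in the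
        hypothesis.\<close>
      show "2 * real k \<le> 1 / 2 * L" using n by (simp add: L_def n_def)
      show "2 * k \<le> card V" using n2 unfolding n_def by linarith
      show "real (card {e \<in> ?E. e \<subseteq> U}) \<le> 1 / 2 * (real (card U))\<^sup>2" if U: "U \<subseteq> V" for U
      proof -
        have fU: "finite U" using U V finite_subset by blast
        have "card {e \<in> ?E. e \<subseteq> U} \<le> card (complete_edges U)"
          unfolding col_edges_restrict[OF U]
          using finite_complete_edges[OF fU] by (intro card_mono) (auto simp: col_edges_def)
        then have "real (card {e \<in> ?E. e \<subseteq> U}) \<le> real (card U) * (real (card U) - 1) / 2"
          using card_complete_edges[OF fU] by (metis of_nat_mono)
        then show ?thesis by (simp add: power2_eq_square algebra_simps)
      qed
      show "real (card U) \<le> L" if "U \<subseteq> V" "k_connected k U {e \<in> ?E. e \<subseteq> U}" for U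
        using small[OF i] that by (simp add: col_edges_restrict)
    qed (use k in auto)
    also have "\<dots> \<le> 1 / 2 * ((n - 1) / real r - 1) * n"
    proof -
      have "0 \<le> (n - 1) / real r - 1" using n k unfolding n_def by linarith
      moreover have "real k - 1 \<le> n" using n2 by linarith
      ultimately show ?thesis using k by (intro mult_mono) (auto simp: L_def n_def)
    qed
    finally show ?thesis by (simp add: col_edges_restrict)
  qed
  have "complete_edges V = (\<Union>i\<in>{1..r}. col_edges f {i} V)"
    unfolding col_edges_def using f by blast
  moreover have "card (\<Union>i\<in>{1..r}. col_edges f {i} V) = (\<Sum>i\<in>{1..r}. card (col_edges f {i} V))"
    using finite_complete_edges[OF V] by (intro card_UN_disjoint) (auto simp: col_edges_def)
  ultimately have "n * (n - 1) / 2 = (\<Sum>i\<in>{1..r}. real (card (col_edges f {i} V)))"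
    using card_complete_edges[OF V] unfolding n_def by simp
  also have "\<dots> \<le> (\<Sum>i\<in>{1..r}. 1 / 2 * ((n - 1) / real r - 1) * n)"
    using bound by (intro sum_mono) auto
  also have "\<dots> = 1 / 2 * (n - 1 - real r) * n"
    using r by (simp add: field_simps)
  finally have "n * (n - 1) \<le> n * (n - 1 - real r)" by (simp add: mult.commute)
  then have "real r * n \<le> 0" by (simp add: algebra_simps)
  then show False using r n2 by (simp add: mult_le_0_iff)
qed

section \<open>Vertices attached to a largest monochromatic piece\<close>

text \<open>\<open>C\<close> is maximal against pieces of every colour, since competitors in colours
  other than \<open>i0\<close> are built below.\<close>

locale maximal_mono =
  fixes f :: "'a set \<Rightarrow> nat" and V :: "'a set" and r k i0 :: nat and C :: "'a set"
  assumes V: "finite V" and colour: "\<And>e. e \<in> complete_edges V \<Longrightarrow> f e \<in> {1..r}"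
    and k: "0 < k" and i0: "i0 \<in> {1..r}" and CV: "C \<subseteq> V"
    and C: "k_connected k C (col_edges f {i0} C)"
    and maximal: "\<And>i U. i \<in> {1..r} \<Longrightarrow> U \<subseteq> V \<Longrightarrow> k_connected k U (col_edges f {i} U) \<Longrightarrow> card U \<le> card C"
begin

definition D :: "'a set" where "D = V - C"
definition d :: "nat \<Rightarrow> 'a \<Rightarrow> nat" where "d i v = card {u \<in> C. f {u, v} = i}"
definition X :: "nat \<Rightarrow> 'a set" where "X i = {v \<in> D. k \<le> d i v}"
text \<open>The exceptions to lying in two of the sets \<open>X j\<close>; they turn out to be
  few.\<close>

definition T :: "nat \<Rightarrow> 'a set" where "T i = {v \<in> X i. \<forall>j\<in>{1..r} - {i}. v \<notin> X j}"

lemma fin: "finite C" "finite D" "finite (X i)" "finite (T i)"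
  using V CV finite_subset by (auto simp: D_def X_def T_def)

lemma X_subset: "X i \<subseteq> V - C"
  by (auto simp: X_def D_def)

lemma card_V: "card V = card C + card D"
  using card_Un_disjoint[OF fin(1,2)] CV by (simp add: D_def Un_absorb1)

lemma sum_d:
  assumes "v \<in> D"
  shows "(\<Sum>i\<in>{1..r}. d i v) = card C"
proof -
  have "C = (\<Union>i\<in>{1..r}. {u \<in> C. f {u, v} = i})"
  proof -
    have "f {u, v} \<in> {1..r}" if "u \<in> C" for u
      using assms CV that by (intro colour complete_edges_doubleton) (auto simp: D_def)
    then show ?thesis by auto
  qed
  moreover have "card (\<Union>i\<in>{1..r}. {u \<in> C. f {u, v} = i}) = (\<Sum>i\<in>{1..r}. d i v)"
    unfolding d_def using fin by (intro card_UN_disjoint) auto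
  ultimately show ?thesis by simp
qed

text \<open>Stated for subsets of \<open>X i\<close>: a single vertex serves to show that
  \<open>X i0\<close> is empty, all of \<open>X i\<close> to get a large subgraph in two
  colours.\<close>

lemma k_connected_add:
  assumes "Y \<subseteq> X i"
  shows "k_connected k (C \<union> Y) (col_edges f {i0, i} (C \<union> Y))"
proof (rule k_connected_Un[OF C])
  show "col_edges f {i0} C \<subseteq> complete_edges C" by (auto simp: col_edges_def)
  show "col_edges f {i0} C \<subseteq> col_edges f {i0, i} (C \<union> Y)"
    by (auto simp: col_edges_def complete_edges_def)
  show "finite Y" using assms fin finite_subset by blast
  fix x assume x: "x \<in> Y"
  then have "x \<notin> C" "k \<le> d i x" using assms by (auto simp: X_def D_def)
  moreover have "{u \<in> C. f {u, x} = i} \<subseteq> {u \<in> C. {x, u} \<in> col_edges f {i0, i} (C \<union> Y)}"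
    using x \<open>x \<notin> C\<close> by (auto simp: col_edges_def complete_edges_def card_2_iff insert_commute)
  then have "d i x \<le> card {u \<in> C. {x, u} \<in> col_edges f {i0, i} (C \<union> Y)}"
    unfolding d_def using fin by (intro card_mono) auto
  ultimately show "k \<le> card {u \<in> C. {x, u} \<in> col_edges f {i0, i} (C \<union> Y)}" by simp
qed

lemma X_i0: "X i0 = {}"
proof (rule ccontr)
  assume "X i0 \<noteq> {}"
  then obtain v where v: "v \<in> X i0" by blast
  then have "k_connected k (C \<union> {v}) (col_edges f {i0} (C \<union> {v}))"
    using k_connected_add[of "{v}" i0] by simp
  then have "card (C \<union> {v}) \<le> card C" using v CV i0 by (intro maximal) (auto simp: X_def D_def)
  then show False using v fin by (simp add: X_def D_def)
qed

text \<open>\<open>edge_bound\<close> applies with \<open>a = 1 / 4\<close>, because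
  \<open>p * q\<close> is at most a quarter of the square of \<open>p + q\<close>, and with
  \<open>L = card C\<close> by maximality.\<close>

lemma card_bipartite_edges:
  assumes big: "8 * k \<le> card C" and i: "i \<in> {1..r}"
  shows "real (\<Sum>v\<in>X i. d i v) \<le> 1 / 4 * (real (card C) + 2 * real k) * (real (card C) + real (card (X i)))"
proof -
  let ?P = "SIGMA v:X i. {u \<in> C. f {u, v} = i}"
  let ?h = "\<lambda>(v, u). {u, v}"
  define B where "B = ?h ` ?P"
  have disj: "C \<inter> X i = {}" by (auto simp: X_def D_def)
  have "inj_on ?h ?P" using disj by (auto simp: inj_on_def doubleton_eq_iff)
  then have cB: "card B = (\<Sum>v\<in>X i. d i v)"
    unfolding B_def d_def using fin by (simp add: card_image)
  have cU: "card (C \<union> X i) = card C + card (X i)" using fin disj by (simp add: card_Un_disjoint)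
  have BE: "{e \<in> B. e \<subseteq> U} \<subseteq> col_edges f {i} U" for U
    using disj by (auto simp: B_def col_edges_def complete_edges_def card_2_iff)
  have "real (card {e \<in> B. e \<subseteq> C \<union> X i})
      \<le> 1 / 4 * (real (card C) + 2 * real k) * (real (card (C \<union> X i)) - (real k - 1))"
  proof (rule edge_bound)
    show "finite (C \<union> X i)" using fin by simp
    show "card e = 2" if "e \<in> B" for e
      using BE[of e] that by (auto simp: col_edges_def complete_edges_def)
    show "2 * real k \<le> 1 / 4 * real (card C)" "2 * k \<le> card (C \<union> X i)"
      using big cU by linarith+
    show "real (card {e \<in> B. e \<subseteq> U}) \<le> 1 / 4 * (real (card U))\<^sup>2" if U: "U \<subseteq> C \<union> X i" for U
    proof -
      let ?p = "card (U \<inter> C)" and ?q = "card (U \<inter> X i)"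
      have fU: "finite U" using U fin finite_subset by blast
      have "{e \<in> B. e \<subseteq> U} \<subseteq> ?h ` ((U \<inter> X i) \<times> (U \<inter> C))" by (auto simp: B_def)
      then have "card {e \<in> B. e \<subseteq> U} \<le> card ((U \<inter> X i) \<times> (U \<inter> C))"
        using fU by (intro surj_card_le) auto
      then have "real (card {e \<in> B. e \<subseteq> U}) \<le> real ?q * real ?p"
        by (simp add: card_cartesian_product flip: of_nat_mult)
      also have "\<dots> \<le> 1 / 4 * (real ?p + real ?q)\<^sup>2"
        using sum_squares_ge_zero[of "real ?p - real ?q" 0] by (simp add: power2_eq_square algebra_simps)
      also have "?p + ?q = card U"
        using card_Un_disjoint[of "U \<inter> C" "U \<inter> X i"] fU disj U by (simp add: Int_Un_distrib[symmetric] Int_absorb2 inf_assoc inf_left_commute)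
      then have "(real ?p + real ?q)\<^sup>2 = (real (card U))\<^sup>2" by (simp flip: of_nat_add)
      finally show ?thesis by simp
    qed
    show "real (card U) \<le> real (card C)" if "U \<subseteq> C \<union> X i" "k_connected k U {e \<in> B. e \<subseteq> U}" for U
    proof -
      have "U \<subseteq> V" using that(1) CV by (auto simp: X_def D_def)
      then show ?thesis using maximal[OF i _ k_connected_mono[OF that(2) BE]] by simp
    qed
  qed (use k in auto)
  also have "{e \<in> B. e \<subseteq> C \<union> X i} = B" by (auto simp: B_def)
  also have "1 / 4 * (real (card C) + 2 * real k) * (real (card (C \<union> X i)) - (real k - 1))
      \<le> 1 / 4 * (real (card C) + 2 * real k) * (real (card C) + real (card (X i)))"
    unfolding cU using k by (intro mult_left_mono) auto
  finally show ?thesis using cB by simp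
qed

text \<open>Of the \<open>card C\<close> edges from a vertex of \<open>D\<close> to
  \<open>C\<close>, at most \<open>r * k\<close> have a colour \<open>i\<close> with the vertex
  outside \<open>X i\<close>. Colour \<open>i0\<close> drops out as \<open>X i0\<close> is
  empty.\<close>

lemma edge_count_le:
  "card D * card C \<le> card D * (r * k) + (\<Sum>i\<in>{1..r} - {i0}. \<Sum>v\<in>X i. d i v)"
proof -
  have vert: "card C \<le> r * k + (\<Sum>i\<in>{1..r} - {i0}. if v \<in> X i then d i v else 0)" if v: "v \<in> D" for v
  proof -
    have "card C \<le> (\<Sum>i\<in>{1..r}. k + (if v \<in> X i then d i v else 0))"
      unfolding sum_d[OF v, symmetric] using v by (intro sum_mono) (auto simp: X_def)
    also have "\<dots> = r * k + (\<Sum>i\<in>{1..r}. if v \<in> X i then d i v else 0)"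
      by (simp add: sum.distrib)
    also have "(\<Sum>i\<in>{1..r}. if v \<in> X i then d i v else 0) = (\<Sum>i\<in>{1..r} - {i0}. if v \<in> X i then d i v else 0)"
      using i0 X_i0 by (simp add: sum.remove)
    finally show ?thesis .
  qed
  have "card D * card C \<le> (\<Sum>v\<in>D. r * k + (\<Sum>i\<in>{1..r} - {i0}. if v \<in> X i then d i v else 0))"
    using sum_mono[of D "\<lambda>_. card C", OF vert] by simp
  also have "\<dots> = card D * (r * k) + (\<Sum>i\<in>{1..r} - {i0}. \<Sum>v\<in>D. if v \<in> X i then d i v else 0)"
    by (simp only: sum.distrib sum_constant of_nat_id sum.swap[of _ D])
  also have "(\<Sum>i\<in>{1..r} - {i0}. \<Sum>v\<in>D. if v \<in> X i then d i v else 0) = (\<Sum>i\<in>{1..r} - {i0}. \<Sum>v\<in>X i. d i v)"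
  proof (rule sum.cong[OF refl])
    fix i
    have "X i = D \<inter> {v. v \<in> X i}" by (auto simp: X_def)
    then show "(\<Sum>v\<in>D. if v \<in> X i then d i v else 0) = (\<Sum>v\<in>X i. d i v)"
      using sum.inter_restrict[OF fin(2), of "d i" "X i"] by (simp add: Int_def)
  qed
  finally show ?thesis .
qed

text \<open>
  A vertex of \<open>T i\<close> sends almost all its edges to \<open>C\<close> in colour \<open>i\<close>, so many such vertices
  would give a \<open>k\<close>-connected graph in colour \<open>i\<close> that is larger than \<open>C\<close>.
\<close>

lemma card_T_le:
  assumes big: "4 * (r * k) + k \<le> card C" and i: "i \<in> {1..r}"
  shows "card (T i) \<le> 2 * (r * k)"
proof (rule ccontr)
  assume neg: "\<not> card (T i) \<le> 2 * (r * k)"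
  have TD: "T i \<subseteq> D" by (auto simp: T_def X_def)
  let ?E = "col_edges f {i} V"
  have rk: "k \<le> r * k" using i by (cases r) auto
  obtain W where W: "W \<subseteq> C" "card C \<le> card W + 2 * (r * k)"
    and conn: "k_connected k (T i \<union> W) {e \<in> ?E. e \<subseteq> T i \<union> W}"
  proof (rule k_connected_almost_complete_bipartite[of k "T i" C ?E "r * k"])
    show "0 < k" "finite (T i)" "finite C" "4 * (r * k) + k \<le> card C" using k fin big by auto
    show "T i \<inter> C = {}" using TD by (auto simp: D_def)
    show "2 * k \<le> card (T i)" using neg rk by linarith
    fix v assume v: "v \<in> T i"
    have "{u \<in> C. {u, v} \<notin> ?E} \<subseteq> (\<Union>j\<in>{1..r} - {i}. {u \<in> C. f {u, v} = j})"
    proof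
      fix u assume u: "u \<in> {u \<in> C. {u, v} \<notin> ?E}"
      have "{u, v} \<in> complete_edges V" using u v TD CV by (intro complete_edges_doubleton) (auto simp: D_def)
      then show "u \<in> (\<Union>j\<in>{1..r} - {i}. {u \<in> C. f {u, v} = j})"
        using u colour[of "{u, v}"] by (auto simp: col_edges_def)
    qed
    then have "card {u \<in> C. {u, v} \<notin> ?E} \<le> card (\<Union>j\<in>{1..r} - {i}. {u \<in> C. f {u, v} = j})"
      using fin by (intro card_mono) auto
    also have "\<dots> \<le> (\<Sum>j\<in>{1..r} - {i}. d j v)" unfolding d_def by (rule card_UN_le) simp
    also have "\<dots> \<le> (\<Sum>j\<in>{1..r} - {i}. k)"
    proof (rule sum_mono)
      fix j assume "j \<in> {1..r} - {i}"
      then have "v \<notin> X j" using v by (simp add: T_def)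
      then show "d j v \<le> k" using v TD by (auto simp: X_def)
    qed
    also have "\<dots> \<le> r * k" by (simp add: card_Diff_singleton_if)
    finally show "card {u \<in> C. {u, v} \<notin> ?E} \<le> r * k" .
  qed (rule that)
  have sub: "T i \<union> W \<subseteq> V" using TD W CV by (auto simp: D_def)
  \<comment> \<open>The new piece gains more than \<open>2 * (r * k)\<close> vertices from
    \<open>T i\<close> and loses at most that many of \<open>C\<close>, against maximality.\<close>
  have "card (T i \<union> W) \<le> card C"
    using maximal[OF i sub] conn col_edges_restrict[OF sub] by metis
  moreover have "card (T i \<union> W) = card (T i) + card W"
    using TD W fin finite_subset[OF W(1)] by (intro card_Un_disjoint) (auto simp: D_def)
  ultimately show False using neg W by linarith
qed

text \<open>The right-hand side counts each vertex of \<open>D\<close> at least twice: it lies in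
  some \<open>X i\<close>, and then either in a second \<open>X j\<close> or in
  \<open>T i\<close>.\<close>

lemma two_card_D_le:
  assumes big: "r * k \<le> card C"
  shows "2 * card D \<le> (\<Sum>i\<in>{1..r} - {i0}. card (X i) + card (T i))"
proof -
  let ?J = "{1..r} - {i0}"
  have r: "0 < r" using i0 by auto
  have vert: "2 \<le> card {i \<in> ?J. v \<in> X i} + card {i \<in> ?J. v \<in> T i}" if v: "v \<in> D" for v
  proof -
    have "\<exists>i\<in>{1..r}. v \<in> X i"
    proof (rule ccontr)
      assume none: "\<not> (\<exists>i\<in>{1..r}. v \<in> X i)"
      have "d i v < k" if "i \<in> {1..r}" for i
      proof (rule ccontr)
        assume "\<not> d i v < k"
        then have "v \<in> X i" using v by (simp add: X_def)
        then show False using none that by blast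
      qed
      then have "(\<Sum>i\<in>{1..r}. d i v) < (\<Sum>i\<in>{1..r}. k)"
        using r by (intro sum_strict_mono) auto
      then show False using sum_d[OF v] big by simp
    qed
    then obtain i where "i \<in> {1..r}" "v \<in> X i" by blast
    then have i: "i \<in> ?J" "v \<in> X i" using X_i0 by auto
    show ?thesis
    proof (cases "v \<in> T i")
      case True
      then have "card {i \<in> ?J. v \<in> X i} \<noteq> 0" "card {i \<in> ?J. v \<in> T i} \<noteq> 0" using i by auto
      then show ?thesis by linarith
    next
      case False
      then obtain j where "j \<in> {1..r} - {i}" "v \<in> X j" using i unfolding T_def by blast
      then have j: "j \<in> ?J" "v \<in> X j" "j \<noteq> i" using X_i0 by auto
      then have "card {i, j} \<le> card {i \<in> ?J. v \<in> X i}" using i by (intro card_mono) auto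
      then show ?thesis using j by simp
    qed
  qed
  have "2 * card D \<le> (\<Sum>v\<in>D. card {i \<in> ?J. v \<in> X i} + card {i \<in> ?J. v \<in> T i})"
    using sum_bounded_below[of D 2, OF vert] by (simp add: mult.commute)
  also have "\<dots> = (\<Sum>i\<in>?J. card {v \<in> D. v \<in> X i} + card {v \<in> D. v \<in> T i})"
    using sum_card_swap[OF fin(2), of ?J "\<lambda>v i. v \<in> X i"] sum_card_swap[OF fin(2), of ?J "\<lambda>v i. v \<in> T i"]
    by (simp add: sum.distrib)
  also have "\<dots> = (\<Sum>i\<in>?J. card (X i) + card (T i))"
  proof (rule sum.cong[OF refl])
    fix i
    have "{v \<in> D. v \<in> X i} = X i" "{v \<in> D. v \<in> T i} = T i" by (auto simp: X_def T_def)
    then show "card {v \<in> D. v \<in> X i} + card {v \<in> D. v \<in> T i} = card (X i) + card (T i)" by simp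
  qed
  finally show ?thesis .
qed

text \<open>\<open>M\<close> is any bound on the sizes of the sets \<open>C \<union> X i\<close>.
  The first inequality counts edges between \<open>C\<close> and \<open>D\<close>, the second counts
  incidences of \<open>D\<close> with the sets \<open>X i\<close>.\<close>

lemma two_colour_bounds:
  fixes M :: real
  assumes r: "2 \<le> r" and big: "4 * (r * k) + 4 * k \<le> card C"
    and M: "\<And>i. i \<in> {1..r} \<Longrightarrow> real (card C + card (X i)) \<le> M"
  shows "real (card D) * (real (card C) - real r * real k)
      \<le> (real r - 1) * (1 / 4 * (real (card C) + 2 * real k) * M)"
    and "2 * real (card D) \<le> (real r - 1) * (M - real (card C) + 2 * real r * real k)"
proof -
  let ?J = "{1..r} - {i0}" and ?c = "real (card C)"
  have cJ: "real (card ?J) = real r - 1" using i0 by (simp add: card_Diff_singleton of_nat_diff)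
  have "2 * k \<le> r * k" using r by simp
  then have big': "8 * k \<le> card C" using big by linarith
  have "real (card D * card C) \<le> real (card D * (r * k) + (\<Sum>i\<in>?J. \<Sum>v\<in>X i. d i v))"
    using edge_count_le by (rule of_nat_mono)
  then have "real (card D) * (?c - real r * real k) \<le> (\<Sum>i\<in>?J. real (\<Sum>v\<in>X i. d i v))"
    by (simp add: algebra_simps)
  also have "\<dots> \<le> (\<Sum>i\<in>?J. 1 / 4 * (?c + 2 * real k) * M)"
  proof (rule sum_mono)
    fix i assume i: "i \<in> ?J"
    have "real (\<Sum>v\<in>X i. d i v) \<le> 1 / 4 * (?c + 2 * real k) * (?c + real (card (X i)))"
      using card_bipartite_edges[OF big'] i by simp
    also have "\<dots> \<le> 1 / 4 * (?c + 2 * real k) * M"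
      using M[of i] i by (intro mult_left_mono) auto
    finally show "real (\<Sum>v\<in>X i. d i v) \<le> 1 / 4 * (?c + 2 * real k) * M" .
  qed
  also have "\<dots> = (real r - 1) * (1 / 4 * (?c + 2 * real k) * M)" by (simp only: sum_constant cJ)
  finally show "real (card D) * (?c - real r * real k) \<le> (real r - 1) * (1 / 4 * (?c + 2 * real k) * M)" .
  have "real (2 * card D) \<le> real (\<Sum>i\<in>?J. card (X i) + card (T i))"
    using two_card_D_le big by (intro of_nat_mono) auto
  also have "\<dots> = (\<Sum>i\<in>?J. real (card (X i)) + real (card (T i)))" by simp
  also have "\<dots> \<le> (\<Sum>i\<in>?J. M - ?c + 2 * real r * real k)"
  proof (rule sum_mono)
    fix i assume i: "i \<in> ?J"
    have "card (T i) \<le> 2 * (r * k)" using card_T_le big i by auto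
    then have "real (card (T i)) \<le> real (2 * (r * k))" by (rule of_nat_mono)
    then show "real (card (X i)) + real (card (T i)) \<le> M - ?c + 2 * real r * real k"
      using M[of i] i by simp
  qed
  also have "\<dots> = (real r - 1) * (M - ?c + 2 * real r * real k)" by (simp only: sum_constant cJ)
  finally show "2 * real (card D) \<le> (real r - 1) * (M - ?c + 2 * real r * real k)" by simp
qed

end

section \<open>The lower bound\<close>

text \<open>If \<open>c \<ge> 2 * m\<close>, the second bound suffices. Otherwise
  \<open>n - c \<ge> (r - 1) * m\<close>, and the first one does.\<close>

lemma two_colour_arith:
  fixes c n r k M m :: real
  assumes r: "3 \<le> r" and k: "1 \<le> k" and m: "n = (r + 1) * m" and cm: "m \<le> c" "0 < m" "r * k \<le> c"
    and 1: "(n - c) * (c - r * k) \<le> (r - 1) * (1 / 4 * (c + 2 * k) * M)"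
    and 2: "2 * (n - c) \<le> (r - 1) * (M - c + 2 * r * k)"
  shows "4 * m - 5 * k * r * (r + 2 * k + 1) \<le> M"
proof (cases "2 * m \<le> c")
  case True
  have "0 \<le> (r - 3) * (c - 2 * m)" using True r by simp
  \<comment> \<open>The two sides differ by exactly \<open>(r - 3) * (c - 2 * m)\<close>.\<close>
  then have "(r - 1) * (4 * m) \<le> (r - 1) * c + 2 * (n - c)" unfolding m by (simp add: algebra_simps)
  also have "\<dots> \<le> (r - 1) * (M + 2 * r * k)" using 2 by (simp add: algebra_simps)
  finally have "4 * m \<le> M + 2 * r * k" using r by simp
  moreover have "2 * (r * k) \<le> 5 * (r + 2 * k + 1) * (r * k)"
    using r k by (intro mult_right_mono) auto
  ultimately show ?thesis by (simp add: algebra_simps)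
next
  case False
  \<comment> \<open>\<open>M \<le> 4 * m - e\<close> would force
    \<open>(c + 2 * k) * e \<le> 4 * m * k * (r + 2)\<close>, which is impossible as
    \<open>c \<ge> m\<close> and \<open>e \<ge> 4 * k * (r + 2)\<close>.\<close>
  define e where "e = 5 * k * r * (r + 2 * k + 1)"
  show ?thesis
  proof (rule ccontr)
    assume "\<not> ?thesis"
    then have M: "M \<le> 4 * m - e" by (simp add: e_def)
    have "(r - 1) * m * (c - r * k) \<le> (n - c) * (c - r * k)"
      using False cm unfolding m by (intro mult_right_mono) (auto simp: algebra_simps)
    then have "(r - 1) * (m * (c - r * k)) \<le> (r - 1) * (1 / 4 * (c + 2 * k) * M)"
      using order_trans[OF _ 1] by (simp only: mult.assoc)
    moreover have "0 < r - 1" using r by simp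
    ultimately have "m * (c - r * k) \<le> 1 / 4 * (c + 2 * k) * M" by (simp only: mult_le_cancel_left_pos)
    also have "\<dots> \<le> 1 / 4 * (c + 2 * k) * (4 * m - e)"
      using M cm k by (intro mult_left_mono) auto
    finally have "(c + 2 * k) * e \<le> 4 * (m * k * (r + 2))" by (simp add: algebra_simps)
    moreover have "(m + 2 * k) * e \<le> (c + 2 * k) * e"
      using cm r k by (intro mult_right_mono) (auto simp: e_def)
    moreover have "4 * (k * (r + 2)) \<le> e"
    proof -
      have "1 * (r + 2) \<le> r * (r + 2 * k + 1)" using r k by (intro mult_mono) auto
      then have "(4 * k) * (r + 2) \<le> (5 * k) * (r * (r + 2 * k + 1))" using r k by (intro mult_mono) auto
      then show ?thesis by (simp add: e_def mult.assoc)
    qed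
    then have "(m + 2 * k) * (4 * (k * (r + 2))) \<le> (m + 2 * k) * e"
      using cm k by (intro mult_left_mono) auto
    ultimately have "8 * (k * (k * (r + 2))) \<le> 0" by (simp add: algebra_simps)
    moreover have "0 < k * (k * (r + 2))" using k r by simp
    ultimately show False by linarith
  qed
qed

lemma max_kconn_lower:
  assumes k: "1 \<le> k" and r: "3 \<le> r" and n: "16 * k * r^2 + 4 * k * r \<le> n"
    and f: "f \<in> colourings n r"
  shows "4 * real n / (real r + 1) - 5 * real k * real r * (real r + 2 * real k + 1)
    \<le> real (max_kconn f n 2 k)"
proof -
  let ?V = "{1..n}" and ?r = "real r" and ?k = "real k" and ?n = "real n"
  have col: "f e \<in> {1..r}" if "e \<in> complete_edges ?V" for e
    using f that by (auto simp: colourings_def)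
  have "real (16 * k * r^2 + 4 * k * r) \<le> ?n" using n by (rule of_nat_mono)
  then have nr: "(16 * ?k * ?r + 4 * ?k) * ?r \<le> ?n" by (simp add: power2_eq_square algebra_simps)
  define P where "P i U \<longleftrightarrow> i \<in> {1..r} \<and> U \<subseteq> ?V \<and> k_connected k U (col_edges f {i} U)" for i U
  have nr1: "16 * ?k * ?r + 4 * ?k - 1 \<le> (?n - 1) / ?r"
  proof -
    have "(16 * ?k * ?r + 4 * ?k - 1) * ?r \<le> ?n - 1" using nr r by (simp add: algebra_simps)
    then show ?thesis using r by (simp add: pos_le_divide_eq)
  qed
  have kr: "3 * ?k \<le> ?k * ?r" using mult_left_mono[of 3 ?r ?k] r by (simp add: mult.commute)
  obtain i1 U1 where iU: "P i1 U1" and U1: "(?n - 1) / ?r - 2 * ?k - 1 \<le> real (card U1)"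
  proof (rule large_mono_k_connected[of ?V f r k])
    have "1 \<le> ?k" using k by simp
    then have "6 * ?k + 1 \<le> (?n - 1) / ?r" using nr1 kr unfolding mult.assoc by linarith
    then show "6 * ?k + 1 \<le> (real (card ?V) - 1) / ?r" by simp
  qed (use col k r that P_def in auto)
  \<comment> \<open>A largest piece is taken over all pairs of a colour and a vertex set.\<close>
  have "\<exists>p. (case p of (i, U) \<Rightarrow> P i U) \<and> (\<forall>q. (case q of (i, U) \<Rightarrow> P i U) \<longrightarrow> card (snd q) \<le> card (snd p))"
  proof (rule ex_has_greatest_nat[of _ "(i1, U1)" _ "n + 1"])
    show "\<forall>q. (case q of (i, U) \<Rightarrow> P i U) \<longrightarrow> card (snd q) < n + 1"
    proof (clarsimp simp: P_def)
      fix U assume "U \<subseteq> {Suc 0..n}"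
      then show "card U < Suc n" using card_mono[of "{Suc 0..n}" U] by simp
    qed
  qed (use iU in simp)
  then obtain i0 C where iC: "P i0 C" and max: "\<And>i U. P i U \<Longrightarrow> card U \<le> card C" by auto
  interpret maximal_mono f ?V r k i0 C
    using iC max col k unfolding P_def by unfold_locales auto
  let ?c = "real (card C)"
  have c: "(?n - 1) / ?r - 2 * ?k - 1 \<le> ?c" using U1 max[OF iU] by linarith
  define m where "m = ?n / (?r + 1)"
  have nm: "?n = (?r + 1) * m" by (simp add: m_def)
  have c16: "16 * ?k * ?r + 2 * ?k - 2 \<le> ?c" using c nr1 by linarith
  have m8: "8 * ?k * ?r \<le> m"
  proof -
    have "(8 * ?k * ?r) * (?r + 1) \<le> (8 * ?k * ?r) * (2 * ?r)" using r by (intro mult_left_mono) auto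
    also have "\<dots> = (16 * ?k * ?r) * ?r" by simp
    also have "\<dots> \<le> (16 * ?k * ?r + 4 * ?k) * ?r" by (intro mult_right_mono) auto
    also note nr
    finally show ?thesis unfolding m_def by (subst pos_le_divide_eq) auto
  qed
  have m0: "0 < m"
  proof -
    have "0 < 8 * ?k * ?r" using k r by simp
    then show ?thesis using m8 by linarith
  qed
  \<comment> \<open>As \<open>?n / ?r\<close> exceeds \<open>m\<close> by \<open>m / ?r\<close>, it
    suffices that \<open>m \<ge> (2 * ?k + 1) * ?r + 1\<close>.\<close>
  have cm: "m \<le> ?c"
  proof -
    have "1 * ?r \<le> ?k * ?r" using k by (intro mult_right_mono) auto
    moreover have "1 \<le> ?r" using r by simp
    ultimately have "(2 * ?k + 1) * ?r + 1 \<le> m"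
      using m8 unfolding distrib_right mult_1 mult.assoc by linarith
    then have "(m + 2 * ?k + 1) * ?r \<le> ?n - 1" unfolding nm by (simp add: algebra_simps)
    then have "m + 2 * ?k + 1 \<le> (?n - 1) / ?r" using r by (simp add: pos_le_divide_eq)
    then show ?thesis using c by linarith
  qed
  have M: "real (card C + card (X i)) \<le> real (max_kconn f n 2 k)" if "i \<in> {1..r}" for i
  proof -
    have "C \<inter> X i = {}" using X_subset by blast
    then have "card C + card (X i) = card (C \<union> X i)" using fin by (simp add: card_Un_disjoint)
    also have "\<dots> \<le> max_kconn f n 2 k"
    proof (rule card_le_max_kconn)
      show "C \<union> X i \<subseteq> ?V" using CV X_subset by blast
      show "k_connected k (C \<union> X i) (col_edges f {i0, i} (C \<union> X i))" by (rule k_connected_add) simp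
      show "col_edges f {i0, i} (C \<union> X i) \<subseteq> complete_edges (C \<union> X i)" by (auto simp: col_edges_def)
      have "card (f ` col_edges f {i0, i} (C \<union> X i)) \<le> card {i0, i}"
        by (intro card_mono) (auto simp: col_edges_def)
      also have "\<dots> \<le> 2" by (simp add: card_insert_if)
      finally show "num_colours f (col_edges f {i0, i} (C \<union> X i)) \<le> 2" by (simp add: num_colours_def)
    qed
    finally show ?thesis by (rule of_nat_mono)
  qed
  have k1: "1 \<le> ?k" using k by simp
  have "4 * (?k * ?r) + 4 * ?k \<le> ?c" using c16 kr k1 unfolding mult.assoc by linarith
  then have "real (4 * (r * k) + 4 * k) \<le> ?c" by (simp add: mult.commute)
  then have big: "4 * (r * k) + 4 * k \<le> card C" by (rule of_nat_le_iff[THEN iffD1])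
  have cD: "real (card D) = ?n - ?c" using card_V by simp
  have "4 * m - 5 * ?k * ?r * (?r + 2 * ?k + 1) \<le> real (max_kconn f n 2 k)"
  proof (rule two_colour_arith[OF _ _ nm cm m0])
    show "(?n - ?c) * (?c - ?r * ?k) \<le> (?r - 1) * (1 / 4 * (?c + 2 * ?k) * real (max_kconn f n 2 k))"
      "2 * (?n - ?c) \<le> (?r - 1) * (real (max_kconn f n 2 k) - ?c + 2 * ?r * ?k)"
      using two_colour_bounds[OF _ big M] r cD by auto
    show "?r * ?k \<le> ?c" using c16 kr k1 unfolding mult.assoc mult.commute[of ?r] by linarith
  qed (use r k in auto)
  then show ?thesis by (simp add: m_def)
qed

theorem theorem1p1:
  fixes r k :: nat
  assumes "k \<ge> 1" and "r \<ge> 3" and "\<exists>j::nat. r + 1 = 2 ^ j"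
  shows "(\<forall>n::nat. n \<ge> 16 * k * r^2 + 4 * k * r \<longrightarrow>
            4 * real n / (real r + 1) - 5 * real k * real r * (real r + 2 * real k + 1)
              \<le> real (min_max_kconn n r 2 k) \<and>
            real (min_max_kconn n r 2 k) \<le> 4 * real n / (real r + 1) + 4) \<and>
         (\<lambda>n::nat. real (min_max_kconn n r 2 k) - 4 * real n / (real r + 1))
           \<in> o[at_top](\<lambda>n. real n)"
proof -
  obtain j where j: "r + 1 = 2 ^ j" using assms(3) by blast
  let ?E = "5 * real k * real r * (real r + 2 * real k + 1)"
  have bounds: "4 * real n / (real r + 1) - ?E \<le> real (min_max_kconn n r 2 k) \<and>
      real (min_max_kconn n r 2 k) \<le> 4 * real n / (real r + 1) + 4"
    if n: "n \<ge> 16 * k * r^2 + 4 * k * r" for n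
  proof
    obtain f where "f \<in> colourings n r" "min_max_kconn n r 2 k = max_kconn f n 2 k"
      using assms(2) by (elim min_max_kconn_attained[rotated]) simp
    then show "4 * real n / (real r + 1) - ?E \<le> real (min_max_kconn n r 2 k)"
      using max_kconn_lower[OF assms(1,2) n] by simp
    show "real (min_max_kconn n r 2 k) \<le> 4 * real n / (real r + 1) + 4"
      using assms j by (intro min_max_kconn_upper) auto
  qed
  \<comment> \<open>For fixed \<open>k\<close> and \<open>r\<close> both error terms are
    constants.\<close>
  moreover have "(\<lambda>n. real (min_max_kconn n r 2 k) - 4 * real n / (real r + 1)) \<in> O(\<lambda>_. 1)"
  proof (rule bigoI[where c = "?E + 4"])
    show "\<forall>\<^sub>F n in at_top. norm (real (min_max_kconn n r 2 k) - 4 * real n / (real r + 1)) \<le> (?E + 4) * norm (1 :: real)"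
      using eventually_ge_at_top[of "16 * k * r^2 + 4 * k * r"]
    proof eventually_elim
      case (elim n)
      have "0 \<le> ?E" by simp
      then show ?case using bounds[OF elim] unfolding real_norm_def abs_one mult_1_right abs_le_iff by linarith
    qed
  qed
  moreover have "(\<lambda>_. 1) \<in> o(\<lambda>n. real n)"
    by (intro smalloI_tendsto) (auto intro!: lim_1_over_n eventually_gt_at_top[THEN eventually_mono])
  ultimately show ?thesis using landau_o.big_small_trans by blast
qed

end
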